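(* Let $q$ and $e$ be coprime positive integers, and let $n := \mathrm{ord}_e(q)$ be the multiplicative order of $q$ modulo $e$ (the least positive integer $s$ with $q^s \equiv 1 \pmod e$). Then $$m(q,e) \le \left\lceil \frac{e}{n} \right\rceil.$$
   Context: For coprime positive integers $q,e$, $m(q,e)$ denotes the least positive integer $t$ such that there exist nonnegative integers $a_1,\ldots,a_t$ (repetitions allowed) with $q^{a_1}+\cdots+q^{a_t} \equiv 0 \pmod e$; equivalently, the least $t$ such that a sum of $t$ elements of the cyclic subgroup $\langle q+e\mathbb{Z}\rangle$ of $(\mathbb{Z}/e\mathbb{Z})^\times$ vanishes in $\mathbb{Z}/e\mathbb{Z}$. *)

theory Defs
  imports "HOL-Number_Theory.Number_Theory"
begin

(* For e > 0 the set of admissible t is nonempty (t = e with all exponents 0),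
   so the least element is a genuine minimum. *)
definition min_vanishing :: "nat \<Rightarrow> nat \<Rightarrow> nat" where
  "min_vanishing q e =
     (LEAST t. t > 0 \<and> (\<exists>a :: nat \<Rightarrow> nat. [(\<Sum>i<t. q ^ a i) = 0] (mod e)))"

end

theory Submission
  imports Defs
begin

text \<open>Let \<open>H\<close> be the subgroup of units generated by \<open>q\<close> and \<open>B = H \<union> {0}\<close>. Chowla's analogue of the
  Cauchy--Davenport theorem gives \<open>|kB| \<ge> min e (k n + 1)\<close>. For \<open>k = \<lceil>e / n\<rceil> - 1\<close> the sizes of \<open>kB\<close>
  and \<open>-H\<close> add up to more than \<open>e\<close>, so the two sets meet, and \<open>0\<close> is a sum of
  at least one and at most \<open>k + 1\<close> elements of \<open>H\<close>.\<close>

definition sumset_mod :: "nat \<Rightarrow> nat set \<Rightarrow> nat set \<Rightarrow> nat set" where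
  "sumset_mod e A B = {(a + b) mod e | a b. a \<in> A \<and> b \<in> B}"

lemma sumset_mod_subset: "e > 0 \<Longrightarrow> sumset_mod e A B \<subseteq> {..<e}"
  by (auto simp: sumset_mod_def)

lemma inj_on_add_mod: "inj_on (\<lambda>x. (a + x) mod e) {..<e :: nat}"
proof (rule inj_onI)
  fix x y assume "x \<in> {..<e}" "y \<in> {..<e}" "(a + x) mod e = (a + y) mod e"
  then show "x = y"
    by (metis cong_add_lcancel_nat cong_def lessThan_iff mod_less)
qed

lemma inj_on_progression_mod:
  fixes a b e :: nat
  assumes "coprime b e"
  shows "inj_on (\<lambda>j. (a + j * b) mod e) {..<e}"
proof (rule inj_onI)
  fix x y assume *: "x \<in> {..<e}" "y \<in> {..<e}" "(a + x * b) mod e = (a + y * b) mod e"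
  then have "[x * b = y * b] (mod e)"
    by (metis cong_add_lcancel_nat cong_def)
  then have "[x = y] (mod e)"
    using assms cong_mult_rcancel_nat coprime_commute by blast
  then show "x = y" using * by (simp add: cong_def)
qed

text \<open>Since \<open>b\<close> is a unit, the progression \<open>a + j * b\<close> with
  \<open>j < e\<close> visits every residue, and closure keeps it inside \<open>A\<close>. In
  \<open>Chowla\<close> this is used in contrapositive form: a proper \<open>A\<close> has an
  element that \<open>b\<close> moves out of \<open>A\<close>.\<close>

lemma translation_invariant_eq_all:
  fixes b e :: nat
  assumes "A \<subseteq> {..<e}" "A \<noteq> {}" "coprime b e"
    and inv: "\<And>a. a \<in> A \<Longrightarrow> (a + b) mod e \<in> A"
  shows "A = {..<e}"
proof -
  obtain a where a: "a \<in> A" using assms by blast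
  have "(a + j * b) mod e \<in> A" for j
  proof (induction j)
    case 0
    then show ?case using a assms(1) by auto
  next
    case (Suc j)
    have "((a + j * b) mod e + b) mod e = (a + Suc j * b) mod e"
      by (simp add: mod_simps algebra_simps)
    then show ?case using inv[OF Suc] by simp
  qed
  then have "(\<lambda>j. (a + j * b) mod e) ` {..<e} \<subseteq> A" by auto
  moreover have "finite A" using assms(1) finite_subset by blast
  ultimately have "e \<le> card A"
    using card_mono card_image[OF inj_on_progression_mod[OF assms(3)]]
    by (metis card_lessThan)
  then show ?thesis using assms(1) by (simp add: card_seteq)
qed

text \<open>Induction on the size of \<open>B\<close>, for all \<open>A\<close> at once because the
  Dyson transform enlarges \<open>A\<close> while it shrinks \<open>B\<close>. Coprimality of the
  nonzero elements of \<open>B\<close> guarantees that a transform with strict shrinking exists as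
  long as \<open>A\<close> is proper.\<close>

lemma Chowla:
  fixes e :: nat
  assumes "A \<subseteq> {..<e}" "A \<noteq> {}" "B \<subseteq> {..<e}" "0 \<in> B"
    and "\<And>b. b \<in> B \<Longrightarrow> b \<noteq> 0 \<Longrightarrow> coprime b e"
  shows "min e (card A + card B - 1) \<le> card (sumset_mod e A B)"
  using assms
proof (induction "card B" arbitrary: A B rule: less_induct)
  case less
  have e: "e > 0" using less.prems by auto
  have fin: "finite A" "finite B" using less.prems finite_subset by blast+
  have fin_sum: "finite (sumset_mod e X Y)" for X Y
    using sumset_mod_subset[OF e] finite_subset by blast
  have A_sub: "A \<subseteq> sumset_mod e A B"
  proof
    fix x assume "x \<in> A"
    then have "x = (x + 0) mod e" using less.prems by auto
    then show "x \<in> sumset_mod e A B"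
      using \<open>x \<in> A\<close> less.prems(4) unfolding sumset_mod_def by blast
  qed
  then have A_le: "card A \<le> card (sumset_mod e A B)" using fin_sum card_mono by blast
  show ?case
  \<comment> \<open>In both base cases the bound is at most \<open>card A\<close>: for
    \<open>B = {0}\<close> it is at most \<open>card A + 1 - 1\<close>, and for full
    \<open>A\<close> it is capped by \<open>e\<close>.\<close>
  proof (cases "B = {0} \<or> A = {..<e}")
    case True
    then show ?thesis using A_le by auto
  next
    case False
    then obtain b where b: "b \<in> B" "b \<noteq> 0" using less.prems by blast
    obtain a where a: "a \<in> A" "(a + b) mod e \<notin> A"
      using translation_invariant_eq_all[OF less.prems(1,2)] less.prems(5)[OF b] False by blast
    \<comment> \<open>Dyson transform: the \<open>b\<close> with \<open>a + b \<notin> A\<close> leave \<open>B\<close> and their translates join \<open>A\<close>,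
      which keeps the total size and does not enlarge the sumset.\<close>
    define B' where "B' = {b \<in> B. (a + b) mod e \<in> A}"
    define C where "C = (\<lambda>b. (a + b) mod e) ` (B - B')"
    have B': "B' \<subset> B" using a b by (auto simp: B'_def)
    have card_lt: "card B' < card B" using B' fin psubset_card_mono by blast
    \<comment> \<open>The base point \<open>a\<close> lies in \<open>A\<close>, so 0 is never moved
      out of \<open>B\<close> and the induction hypothesis stays applicable.\<close>
    have "0 \<in> B'" using a(1) less.prems by (auto simp: B'_def)
    have "inj_on (\<lambda>b. (a + b) mod e) (B - B')"
      using inj_on_add_mod inj_on_subset less.prems(3) by (metis Diff_subset subset_trans)
    then have "card C = card B - card B'"
      using card_image card_Diff_subset[of B' B] B' fin finite_subset
      by (metis C_def psubset_imp_subset)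
    moreover have "A \<inter> C = {}" by (auto simp: C_def B'_def)
    ultimately have card_AC: "card (A \<union> C) = card A + (card B - card B')"
      using fin by (simp add: card_Un_disjoint C_def)
    have "min e (card (A \<union> C) + card B' - 1) \<le> card (sumset_mod e (A \<union> C) B')"
    proof (rule less.hyps[OF card_lt])
      show "A \<union> C \<subseteq> {..<e}" using less.prems(1) e by (auto simp: C_def)
    qed (use B' less.prems \<open>0 \<in> B'\<close> in auto)
    also have "sumset_mod e (A \<union> C) B' \<subseteq> sumset_mod e A B"
    proof
      fix x assume "x \<in> sumset_mod e (A \<union> C) B'"
      then obtain c d where x: "x = (c + d) mod e" "c \<in> A \<union> C" "d \<in> B'"
        by (auto simp: sumset_mod_def)
      show "x \<in> sumset_mod e A B"
      proof (cases "c \<in> A")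
        case True
        then show ?thesis using x B' by (auto simp: sumset_mod_def)
      next
        case False
        then obtain f where f: "f \<in> B" "c = (a + f) mod e" using x by (auto simp: C_def)
        \<comment> \<open>The two shifts trade places: \<open>(a + f) + d = (a + d) + f\<close>,
          where \<open>a + d\<close> lies in \<open>A\<close> because \<open>d\<close> stayed in
          \<open>B'\<close>.\<close>
        have "x = ((a + d) mod e + f) mod e"
          using x(1) f(2) by (simp add: mod_simps algebra_simps)
        moreover have "(a + d) mod e \<in> A" using x(3) by (simp add: B'_def)
        ultimately show ?thesis using f(1) by (auto simp: sumset_mod_def)
      qed
    qed
    then have "card (sumset_mod e (A \<union> C) B') \<le> card (sumset_mod e A B)"
      using fin_sum card_mono by blast
    finally show ?thesis using card_AC card_lt by simp
  qed
qed

text \<open>This is the \<open>k\<close>-fold sumset of \<open>H \<union> {0}\<close>: choosing 0 as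
  a summand amounts to dropping a term, hence at most \<open>k\<close> terms, the empty sum
  included.\<close>

definition power_sums :: "nat \<Rightarrow> nat \<Rightarrow> nat \<Rightarrow> nat set" where
  "power_sums q e k = {s. s < e \<and> (\<exists>t\<le>k. \<exists>a :: nat \<Rightarrow> nat. [(\<Sum>i<t. q ^ a i) = s] (mod e))}"

lemma sum_power_snoc:
  fixes q :: nat
  obtains a' :: "nat \<Rightarrow> nat" where "(\<Sum>i<Suc t. q ^ a' i) = (\<Sum>i<t. q ^ a i) + q ^ m"
proof -
  have "(\<Sum>i<t. q ^ (a(t := m)) i) = (\<Sum>i<t. q ^ a i)" by (intro sum.cong) auto
  then show thesis using that[of "a(t := m)"] by simp
qed

lemma power_sums_add:
  assumes "s \<in> power_sums q e k"
  shows "(s + q ^ m mod e) mod e \<in> power_sums q e (Suc k)"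
proof -
  obtain t a where t: "s < e" "t \<le> k" "[(\<Sum>i<t. q ^ a i) = s] (mod e)"
    using assms by (auto simp: power_sums_def)
  obtain a' where a': "(\<Sum>i<Suc t. q ^ a' i) = (\<Sum>i<t. q ^ a i) + q ^ m"
    using sum_power_snoc .
  have "[(\<Sum>i<Suc t. q ^ a' i) = (s + q ^ m mod e) mod e] (mod e)"
    unfolding a' using t(3) by (metis cong_add cong_def mod_add_right_eq mod_mod_trivial)
  moreover have "(s + q ^ m mod e) mod e < e" using t(1) by simp
  ultimately show ?thesis using t(2) unfolding power_sums_def by blast
qed

lemma card_powers_mod:
  fixes q e :: nat
  assumes "coprime q e"
  shows "card ((\<lambda>i. q ^ i mod e) ` {..<ord e q}) = ord e q"
proof -
  have "inj_on (\<lambda>i. q ^ i mod e) {..<ord e q}"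
    using inj_power_mod[of e q] assms by (simp add: coprime_commute)
  then show ?thesis by (simp add: card_image)
qed

text \<open>Each further summand from \<open>insert 0 H\<close> gains
  \<open>card H = ord e q\<close> residues by \<open>Chowla\<close>, until all \<open>e\<close> are
  reached.\<close>

lemma card_power_sums:
  assumes "e > 1" "coprime q e"
  shows "min e (k * ord e q + 1) \<le> card (power_sums q e k)"
proof (induction k)
  case 0
  have "power_sums q e 0 = {0}" using assms(1) by (auto simp: power_sums_def cong_def)
  then show ?case by simp
next
  case (Suc k)
  define H where "H = (\<lambda>i. q ^ i mod e) ` {..<ord e q}"
  let ?P = "power_sums q e"
  have H: "coprime h e" "h < e" if "h \<in> H" for h
    using that assms by (auto simp: H_def)
  \<comment> \<open>For \<open>e > 1\<close> zero is not a unit, so inserting it really adds an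
    element, which offsets the \<open>- 1\<close> in \<open>Chowla\<close>.\<close>
  then have "0 \<notin> H" using assms(1) by fastforce
  then have card_B: "card (insert 0 H) = ord e q + 1"
    using card_powers_mod[OF assms(2)] by (simp add: H_def)
  have zero: "0 \<in> ?P k" using assms(1) by (auto simp: power_sums_def intro!: exI[of _ 0])
  have "min e (card (?P k) + card (insert 0 H) - 1) \<le> card (sumset_mod e (?P k) (insert 0 H))"
  proof (rule Chowla)
    show "?P k \<noteq> {}" using zero by blast
  qed (use H assms(1) in \<open>auto simp: power_sums_def\<close>)
  also have "\<dots> \<le> card (?P (Suc k))"
  proof (rule card_mono)
    show "finite (?P (Suc k))" by (simp add: power_sums_def)
    show "sumset_mod e (?P k) (insert 0 H) \<subseteq> ?P (Suc k)"
    proof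
      fix x assume "x \<in> sumset_mod e (?P k) (insert 0 H)"
      then obtain s b where x: "x = (s + b) mod e" "s \<in> ?P k" "b \<in> insert 0 H"
        by (auto simp: sumset_mod_def)
      show "x \<in> ?P (Suc k)"
      proof (cases "b = 0")
        case True
        then have "x = s" using x by (simp add: power_sums_def)
        then show ?thesis using x(2) le_SucI unfolding power_sums_def by blast
      next
        case False
        then show ?thesis using x power_sums_add by (auto simp: H_def)
      qed
    qed
  qed
  finally show ?case using Suc card_B by simp
qed

lemma min_vanishing_le:
  assumes "t > 0" "[(\<Sum>i<t. q ^ a i) = 0] (mod e)"
  shows "min_vanishing q e \<le> t"
  unfolding min_vanishing_def using assms by (intro Least_le) blast

lemma min_vanishing_le_Suc:
  fixes q e k :: nat
  assumes "e > 0" "coprime q e" "e \<le> Suc k * ord e q"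
  shows "min_vanishing q e \<le> Suc k"
\<comment> \<open>Modulo 1 zero is itself a unit and the size count breaks down, but every sum
  vanishes.\<close>
proof (cases "e = 1")
  case True
  then show ?thesis using min_vanishing_le[of "Suc k"] by simp
next
  case False
  then have e: "e > 1" using assms(1) by simp
  define H where "H = (\<lambda>i. q ^ i mod e) ` {..<ord e q}"
  \<comment> \<open>The set \<open>-H\<close>; the representatives \<open>e - h\<close> are below
    \<open>e\<close> because every \<open>h\<close> in \<open>H\<close> is positive.\<close>
  define N where "N = (\<lambda>h. e - h) ` H"
  have H: "0 < h" "h < e" if "h \<in> H" for h
  proof -
    obtain i where i: "h = q ^ i mod e" using \<open>h \<in> H\<close> by (auto simp: H_def)
    then have "coprime h e" using assms by simp
    then show "0 < h" using e by (cases "h = 0") auto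
    show "h < e" using i e by simp
  qed
  have "inj_on (\<lambda>h. e - h) H"
  proof (rule inj_onI)
    fix x y assume "x \<in> H" "y \<in> H" "e - x = e - y"
    then show "x = y" using H(2)[of x] H(2)[of y] by simp
  qed
  then have "card N = ord e q"
    using card_powers_mod[OF assms(2)] by (simp add: N_def H_def card_image)
  have N: "N \<subseteq> {..<e}" using H(1) assms(1) by (auto simp: N_def intro!: diff_less)
  have P: "power_sums q e k \<subseteq> {..<e}" by (auto simp: power_sums_def)
  have "power_sums q e k \<inter> N \<noteq> {}"
  proof
    assume "power_sums q e k \<inter> N = {}"
    then have "card (power_sums q e k) + card N = card (power_sums q e k \<union> N)"
      using N P by (metis card_Un_disjoint finite_lessThan finite_subset)
    also have "\<dots> \<le> e" using N P card_mono[of "{..<e}"] by simp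
    finally have "min e (k * ord e q + 1) + ord e q \<le> e"
      using card_power_sums[OF e assms(2), of k] \<open>card N = ord e q\<close> by simp
    moreover have "ord e q > 0" using assms by (simp add: coprime_commute)
    \<comment> \<open>If the minimum is \<open>e\<close>, then \<open>ord e q > 0\<close> is
      contradicted; otherwise \<open>Suc k * ord e q + 1 \<le> e\<close>, against the assumption on
      \<open>e\<close>.\<close>
    ultimately show False using assms(3) by (auto simp: min_def split: if_splits)
  qed
  then obtain m where m: "e - q ^ m mod e \<in> power_sums q e k"
    by (auto simp: N_def H_def)
  then obtain t a where t: "t \<le> k" "[(\<Sum>i<t. q ^ a i) = e - q ^ m mod e] (mod e)"
    by (auto simp: power_sums_def)
  \<comment> \<open>Appending \<open>q ^ m\<close> cancels the residue \<open>- q ^ m\<close> and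
    leaves a nonempty sum even when \<open>t = 0\<close>.\<close>
  obtain a' where a': "(\<Sum>i<Suc t. q ^ a' i) = (\<Sum>i<t. q ^ a i) + q ^ m"
    using sum_power_snoc .
  have "[(\<Sum>i<Suc t. q ^ a' i) = (e - q ^ m mod e) + q ^ m mod e] (mod e)"
    unfolding a' using t(2) by (intro cong_add) (auto simp: cong_def)
  also have "(e - q ^ m mod e) + q ^ m mod e = e" using e by simp
  finally have "[(\<Sum>i<Suc t. q ^ a' i) = 0] (mod e)" by (simp add: cong_def)
  then have "min_vanishing q e \<le> Suc t" using min_vanishing_le by blast
  then show ?thesis using t(1) by simp
qed

theorem theorem1:
  fixes q e n :: nat
  assumes "q > 0" and "e > 0" and "coprime q e"
    and "n = ord e q"
  shows "int (min_vanishing q e) \<le> \<lceil>real e / real n\<rceil>"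
proof -
  have n: "n > 0" using assms by (simp add: coprime_commute)
  define c where "c = nat \<lceil>real e / real n\<rceil>"
  have pos: "real e / real n > 0" using assms(2) n by simp
  then have c: "int c = \<lceil>real e / real n\<rceil>" by (simp add: c_def)
  then have "c > 0" using pos by (simp add: c_def)
  \<comment> \<open>The ceiling is positive, so one summand can be reserved for the final
    cancellation and \<open>k\<close> remain for the sumset.\<close>
  then obtain k where k: "c = Suc k" by (cases c) auto
  have "real e / real n \<le> real c" using c by (metis le_of_int_ceiling of_int_of_nat_eq)
  then have "real e \<le> real (c * n)" using n by (simp add: field_simps)
  then have "e \<le> Suc k * ord e q" using k assms(4) by (metis of_nat_le_iff)
  then show ?thesis using min_vanishing_le_Suc[OF assms(2,3)] c k by (metis of_nat_le_iff)
qed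

end
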